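(* Let $K$ be a field with $K\neq\mathbb{F}_2$, let $X$ be a finite-dimensional vector space over $K$, and let $\omega$ be a (possibly degenerate) alternating $K$-valued bilinear form on $X$. Let $S$ be a spanning subset of $X$ such that the graph $G(S)$ is connected. Then two nonzero elements $\alpha,\beta\in X^\ast$ belong to the same orbit of $\Gamma_S^\ast$ if and only if $\beta-\alpha\in\operatorname{im}\omega$.
   Context: The form $\omega$ also denotes the linear map $\omega:X\to X^\ast$ given by $\omega(x)(y)=\omega(x,y)$, and $\operatorname{im}\omega$ is the image of this map. For $s\in X$ and nonzero $k\in K$, the transvection $T_{s,k}:X\to X$ is $T_{s,k}(x)=x+k\,\omega(x,s)\,s$. For a subset $S\subseteq X$ (possibly infinite), $\Gamma_S$ is the subgroup of $\mathrm{GL}(X)$ generated by all $T_{s,k}$ with $s\in S$ and $k\in K\setminus\{0\}$. For $g\in\mathrm{GL}(X)$, $g^\ast\in\mathrm{GL}(X^\ast)$ is defined by $g^\ast(\alpha)=\alpha\circ g$, and $\Gamma_S^\ast=\{g^\ast: g\in\Gamma_S\}$, a subgroup of $\mathrm{GL}(X^\ast)$ acting on $X^\ast$. $G(S)$ is the (possibly infinite) graph with vertex set $S$ and an edge between $u$ and $v$ if $\omega(u,v)\neq 0$. *)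

theory Defs
  imports "HOL-Algebra.Group_Action" "HOL-Algebra.Generated_Groups"
    "Graph_Theory.Digraph_Component"
begin

text \<open>
  The field \<open>K\<close> is a type \<open>'k::field\<close>; the vector space \<open>X\<close> is a whole type \<open>'x\<close>
  with scalar multiplication \<open>scale\<close>, as in \<^locale>\<open>vector_space\<close>.  A form \<open>\<omega>\<close> is curried, so
  it is literally the map \<open>X \<Rightarrow> X\<^sup>*\<close> and \<open>im \<omega>\<close> is \<open>range \<omega>\<close>.
\<close>

definition alternating_bilinear_form ::
  "('k::field \<Rightarrow> 'x::ab_group_add \<Rightarrow> 'x) \<Rightarrow> ('x \<Rightarrow> 'x \<Rightarrow> 'k) \<Rightarrow> bool"
  where "alternating_bilinear_form scale \<omega> \<longleftrightarrow>
    (\<forall>x. Vector_Spaces.linear scale (*) (\<lambda>y. \<omega> x y)) \<and>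
    (\<forall>y. Vector_Spaces.linear scale (*) (\<lambda>x. \<omega> x y)) \<and>
    (\<forall>x. \<omega> x x = 0)"

definition dual_space :: "('k::field \<Rightarrow> 'x::ab_group_add \<Rightarrow> 'x) \<Rightarrow> ('x \<Rightarrow> 'k) set"
  where "dual_space scale = {\<alpha>. Vector_Spaces.linear scale (*) \<alpha>}"

definition GL :: "('k::field \<Rightarrow> 'x::ab_group_add \<Rightarrow> 'x) \<Rightarrow> ('x \<Rightarrow> 'x) monoid"
  where "GL scale =
    \<lparr>carrier = {g. Vector_Spaces.linear scale scale g \<and> bij g}, monoid.mult = (\<circ>), one = id\<rparr>"

definition transvection ::
  "('k::field \<Rightarrow> 'x::ab_group_add \<Rightarrow> 'x) \<Rightarrow> ('x \<Rightarrow> 'x \<Rightarrow> 'k) \<Rightarrow> 'x \<Rightarrow> 'k \<Rightarrow> 'x \<Rightarrow> 'x"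
  where "transvection scale \<omega> s k = (\<lambda>x. x + scale (k * \<omega> x s) s)"

definition Gamma ::
  "('k::field \<Rightarrow> 'x::ab_group_add \<Rightarrow> 'x) \<Rightarrow> ('x \<Rightarrow> 'x \<Rightarrow> 'k) \<Rightarrow> 'x set \<Rightarrow> ('x \<Rightarrow> 'x) set"
  where "Gamma scale \<omega> S =
    generate (GL scale) {transvection scale \<omega> s k | s k. s \<in> S \<and> k \<noteq> 0}"

text \<open>
  The map \<open>g\<^sup>*\<close> lives on \<open>X\<^sup>*\<close>, which is a proper subset of the function type; it is made
  extensional there, as \<^const>\<open>BijGroup\<close> requires.
\<close>

definition dual_map ::
  "('k::field \<Rightarrow> 'x::ab_group_add \<Rightarrow> 'x) \<Rightarrow> ('x \<Rightarrow> 'x) \<Rightarrow> ('x \<Rightarrow> 'k) \<Rightarrow> ('x \<Rightarrow> 'k)"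
  where "dual_map scale g = (\<lambda>\<alpha> \<in> dual_space scale. \<alpha> \<circ> g)"

definition Gamma_dual ::
  "('k::field \<Rightarrow> 'x::ab_group_add \<Rightarrow> 'x) \<Rightarrow> ('x \<Rightarrow> 'x \<Rightarrow> 'k) \<Rightarrow> 'x set
    \<Rightarrow> (('x \<Rightarrow> 'k) \<Rightarrow> ('x \<Rightarrow> 'k)) monoid"
  where "Gamma_dual scale \<omega> S =
    (BijGroup (dual_space scale))\<lparr>carrier := dual_map scale ` Gamma scale \<omega> S\<rparr>"

text \<open>
  An undirected edge is represented by its two arcs.  The library's \<^const>\<open>connected\<close>
  excludes the empty graph.
\<close>

definition form_graph :: "('x \<Rightarrow> 'x \<Rightarrow> 'k::field) \<Rightarrow> 'x set \<Rightarrow> 'x pair_pre_digraph"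
  where "form_graph \<omega> S =
    \<lparr>pverts = S, parcs = {(u, v). u \<in> S \<and> v \<in> S \<and> \<omega> u v \<noteq> 0}\<rparr>"


subsection \<open>The objects above are what they are meant to be\<close>

lemma group_GL:
  assumes "vector_space scale"
  shows "group (GL scale)"
proof -
  interpret vector_space scale by fact
  interpret vector_space_pair scale scale by unfold_locales
  show ?thesis
  proof (rule groupI)
    fix g assume g: "g \<in> carrier (GL scale)"
    then have l: "Vector_Spaces.linear scale scale g" and b: "bij g"
      by (auto simp: GL_def)
    have inv: "g (the_inv g z) = z" "the_inv g (g z) = z" for z
      using b by (auto simp: bij_def f_the_inv_into_f the_inv_f_f)
    have "the_inv g (x + y) = the_inv g x + the_inv g y" for x y
      by (metis inv l linear_add)
    moreover have "the_inv g (scale c x) = scale c (the_inv g x)" for c x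
      by (metis inv l linear_scale)
    ultimately have "Vector_Spaces.linear scale scale (the_inv g)"
      using vector_space_axioms by (simp add: Vector_Spaces.linear_iff)
    then show "\<exists>h\<in>carrier (GL scale). h \<otimes>\<^bsub>GL scale\<^esub> g = \<one>\<^bsub>GL scale\<^esub>"
      using b by (intro bexI[of _ "the_inv g"])
        (auto simp: GL_def inv fun_eq_iff bij_betw_the_inv_into)
  qed (auto simp: GL_def o_assoc bij_comp linear_id Vector_Spaces.linear_compose id_def[symmetric])
qed

lemma transvection_in_GL:
  assumes "vector_space scale" and "alternating_bilinear_form scale \<omega>"
  shows "transvection scale \<omega> s k \<in> carrier (GL scale)"
proof -
  interpret vector_space scale by fact
  have L: "Vector_Spaces.linear scale (*) (\<lambda>x. \<omega> x s)" and [simp]: "\<omega> s s = 0"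
    using assms(2) by (auto simp: alternating_bilinear_form_def)
  interpret f: Vector_Spaces.linear scale "(*)" "\<lambda>x. \<omega> x s" by (rule L)
  interpret vector_space_pair scale scale by unfold_locales
  have inv: "transvection scale \<omega> s (- c) (transvection scale \<omega> s c x) = x" for c x
    by (simp add: transvection_def f.add f.scale)
  have "bij (transvection scale \<omega> s k)"
    by (rule o_bij[of "transvection scale \<omega> s (- k)"])
      (use inv[of k] inv[of "- k"] in \<open>auto simp: fun_eq_iff\<close>)
  moreover have "Vector_Spaces.linear scale scale (transvection scale \<omega> s k)"
    using vector_space_axioms
    by (auto simp: Vector_Spaces.linear_iff transvection_def f.add f.scale
        scale_left_distrib scale_right_distrib distrib_left mult.left_commute add_ac)
  ultimately show ?thesis by (simp add: GL_def)
qed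

lemma subgroup_Gamma:
  assumes "vector_space scale" and "alternating_bilinear_form scale \<omega>"
  shows "subgroup (Gamma scale \<omega> S) (GL scale)"
  unfolding Gamma_def
  by (rule group.generate_is_subgroup[OF group_GL[OF assms(1)]])
    (use transvection_in_GL[OF assms] in blast)

lemma dual_map_hom:
  assumes "vector_space scale"
    and "g \<in> carrier (GL scale)" "h \<in> carrier (GL scale)"
  shows "dual_map scale (g \<circ> h) =
    compose (dual_space scale) (dual_map scale h) (dual_map scale g)"
proof -
  have "\<alpha> \<circ> g \<in> dual_space scale" if "\<alpha> \<in> dual_space scale" for \<alpha>
    using that assms(2) Vector_Spaces.linear_compose[of scale scale g "(*)" \<alpha>]
    by (auto simp: GL_def dual_space_def)
  then show ?thesis
    by (auto simp: dual_map_def compose_def fun_eq_iff)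
qed

lemma dual_map_Bij:
  assumes "vector_space scale" and g: "g \<in> carrier (GL scale)"
  shows "dual_map scale g \<in> Bij (dual_space scale)"
proof -
  interpret GL: group "GL scale" by (rule group_GL) fact
  have closed: "\<alpha> \<circ> h \<in> dual_space scale"
    if "\<alpha> \<in> dual_space scale" "h \<in> carrier (GL scale)" for \<alpha> h
    using that Vector_Spaces.linear_compose[of scale scale h "(*)" \<alpha>]
    by (auto simp: GL_def dual_space_def)
  let ?h = "inv\<^bsub>GL scale\<^esub> g"
  have h: "?h \<in> carrier (GL scale)" using g by simp
  have gh: "g \<circ> ?h = id" "?h \<circ> g = id"
    using GL.r_inv[OF g] GL.l_inv[OF g] by (simp_all add: GL_def)
  have "bij_betw (dual_map scale g) (dual_space scale) (dual_space scale)"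
    by (rule bij_betw_byWitness[where f' = "dual_map scale ?h"])
      (auto simp: dual_map_def closed g h comp_assoc gh)
  then show ?thesis by (simp add: Bij_def dual_map_def)
qed

lemma subgroup_Gamma_dual:
  assumes vs: "vector_space scale" and alt: "alternating_bilinear_form scale \<omega>"
  shows "subgroup (carrier (Gamma_dual scale \<omega> S)) (BijGroup (dual_space scale))"
proof -
  interpret GL: group "GL scale" by (rule group_GL) fact
  interpret B: group "BijGroup (dual_space scale)" by (rule group_BijGroup)
  interpret H: subgroup "Gamma scale \<omega> S" "GL scale" by (rule subgroup_Gamma) fact+
  have B: "dual_map scale g \<in> carrier (BijGroup (dual_space scale))"
    if "g \<in> carrier (GL scale)" for g
    using dual_map_Bij[OF vs that] by (simp add: BijGroup_def)
  have mult: "dual_map scale h \<otimes>\<^bsub>BijGroup (dual_space scale)\<^esub> dual_map scale g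
      = dual_map scale (g \<otimes>\<^bsub>GL scale\<^esub> h)"
    if "g \<in> carrier (GL scale)" "h \<in> carrier (GL scale)" for g h
    using dual_map_hom[OF vs that] dual_map_Bij[OF vs that(1)] dual_map_Bij[OF vs that(2)]
    by (simp add: BijGroup_def) (simp add: GL_def)
  have one: "dual_map scale \<one>\<^bsub>GL scale\<^esub> = \<one>\<^bsub>BijGroup (dual_space scale)\<^esub>"
    by (simp add: GL_def BijGroup_def dual_map_def)
  have inv: "inv\<^bsub>BijGroup (dual_space scale)\<^esub> dual_map scale g
      = dual_map scale (inv\<^bsub>GL scale\<^esub> g)" if "g \<in> carrier (GL scale)" for g
    by (rule B.inv_equality) (use that in \<open>simp_all add: mult one B\<close>)
  have "subgroup (dual_map scale ` Gamma scale \<omega> S) (BijGroup (dual_space scale))"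
  proof (rule B.subgroupI)
    show "dual_map scale ` Gamma scale \<omega> S \<subseteq> carrier (BijGroup (dual_space scale))"
      using B by auto
    show "dual_map scale ` Gamma scale \<omega> S \<noteq> {}"
      using H.one_closed by blast
  qed (auto simp: inv mult)
  then show ?thesis by (simp add: Gamma_dual_def)
qed

lemma group_action_Gamma_dual:
  assumes "vector_space scale" and "alternating_bilinear_form scale \<omega>"
  shows "group_action (Gamma_dual scale \<omega> S) (dual_space scale) (\<lambda>h. h)"
proof -
  interpret B: group "BijGroup (dual_space scale)" by (rule group_BijGroup)
  note sub = subgroup_Gamma_dual[OF assms, of S]
  have "group (Gamma_dual scale \<omega> S)"
    using subgroup.subgroup_is_group[OF sub B.is_group] by (simp add: Gamma_dual_def)
  moreover have "(\<lambda>h. h) \<in> hom (Gamma_dual scale \<omega> S) (BijGroup (dual_space scale))"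
    using subgroup.subset[OF sub] by (auto simp: hom_def Gamma_dual_def)
  ultimately show ?thesis
    by (simp add: group_action_def group_hom_def group_hom_axioms_def B.is_group)
qed

end

theory Submission
  imports Defs "HOL-Library.Function_Algebras"
begin

text \<open>
  Dually, a transvection moves \<open>\<alpha>\<close> to \<open>\<alpha> - k \<alpha>(s) \<omega>(s,\<cdot>)\<close>, so orbits stay within cosets of \<open>im \<omega>\<close>.
  Conversely, let \<open>R\<close> be the set of all \<open>x\<close> with \<open>T\<^bsub>x,k\<^esub> \<in> \<Gamma>\<^sub>S\<close> for all \<open>k\<close>.  It contains the radical
  of \<open>\<omega>\<close>, is closed under scalar multiples and, because \<open>T\<^bsub>v,k\<^esub> T\<^bsub>u,m\<^esub> T\<^bsub>v,-k\<^esub>\<close> is the transvection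
  along \<open>T\<^bsub>v,k\<^esub> u\<close>, under sums of two vectors that are not orthogonal.  When \<open>K\<close> has a third element,
  two vectors of \<open>R\<close> with a common neighbour in \<open>R\<close> have their sum in \<open>R\<close>; hence having a common
  neighbour is a transitive relation, and connectedness of \<open>G(S)\<close> gives \<open>R = X\<close>.
  Let now \<open>\<beta> = \<alpha> + \<omega>(x,\<cdot>)\<close>.  If \<open>\<alpha>(x) \<noteq> 0\<close>, one transvection along \<open>x\<close> suffices;
  otherwise choose \<open>y\<close> with \<open>\<alpha>(y) \<noteq> 0\<close> and \<open>\<beta>(y) \<noteq> 0\<close>: a transvection along \<open>y\<close> followed by one along \<open>x - y\<close> takes \<open>\<alpha>\<close> to \<open>\<alpha> + \<omega>(y,\<cdot>)\<close> and then to \<open>\<beta>\<close>.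
\<close>

section \<open>The form, its radical and spanning sets\<close>

locale alternating_form = vector_space scale
  for scale :: "'k::field \<Rightarrow> 'x::ab_group_add \<Rightarrow> 'x" +
  fixes \<omega> :: "'x \<Rightarrow> 'x \<Rightarrow> 'k"
  assumes alternating: "alternating_bilinear_form scale \<omega>"
begin

lemma form_add_right [simp]: "\<omega> x (y + z) = \<omega> x y + \<omega> x z"
  and form_scale_right [simp]: "\<omega> x (scale c y) = c * \<omega> x y"
  and form_add_left [simp]: "\<omega> (x + y) z = \<omega> x z + \<omega> y z"
  and form_scale_left [simp]: "\<omega> (scale c x) z = c * \<omega> x z"
  and form_self [simp]: "\<omega> x x = 0"
  using alternating by (auto simp: alternating_bilinear_form_def Vector_Spaces.linear_iff)

lemma form_zero_left [simp]: "\<omega> 0 x = 0"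
  and form_zero_right [simp]: "\<omega> x 0 = 0"
  using form_scale_left[of 0 0 x] form_scale_right[of x 0 0] by simp_all

lemma form_minus_left [simp]: "\<omega> (- x) y = - \<omega> x y"
  and form_minus_right [simp]: "\<omega> x (- y) = - \<omega> x y"
  using form_scale_left[of "-1" x y] form_scale_right[of x "-1" y] by simp_all

lemma form_diff_left [simp]: "\<omega> (x - y) z = \<omega> x z - \<omega> y z"
  and form_diff_right [simp]: "\<omega> x (y - z) = \<omega> x y - \<omega> x z"
  using form_add_left[of "x - y" y z] form_add_right[of x "y - z" z] by simp_all

lemma form_swap: "\<omega> y x = - \<omega> x y"
  using form_self[of "x + y"] by (simp del: form_self add: form_self[of x] form_self[of y] add_eq_0_iff)

lemma form_eq_0_swap: "\<omega> y x = 0 \<longleftrightarrow> \<omega> x y = 0"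
  by (simp add: form_swap[of y x])

definition radical :: "'x set"
  where "radical = {x. \<forall>y. \<omega> x y = 0}"

lemma not_radicalI: "\<omega> x y \<noteq> 0 \<Longrightarrow> x \<notin> radical"
  by (auto simp: radical_def)

lemma add_radical_iff: "r \<in> radical \<Longrightarrow> r + x \<in> radical \<longleftrightarrow> x \<in> radical"
  by (simp add: radical_def)

lemma scale_radical_iff: "scale c x \<in> radical \<longleftrightarrow> c = 0 \<or> x \<in> radical"
  by (auto simp: radical_def)

lemma not_radical_obtains:
  assumes "span S = UNIV" "x \<notin> radical"
  obtains z where "z \<in> S" "\<omega> x z \<noteq> 0"
proof -
  have "\<exists>z\<in>S. \<omega> x z \<noteq> 0"
  proof (rule ccontr)
    assume "\<not> (\<exists>z\<in>S. \<omega> x z \<noteq> 0)"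
    moreover have "subspace {y. \<omega> x y = 0}"
      by (auto simp: subspace_def)
    ultimately have "span S \<subseteq> {y. \<omega> x y = 0}"
      by (intro span_minimal) auto
    with assms show False by (auto simp: radical_def)
  qed
  then show ?thesis using that by blast
qed

section \<open>Transvections on vectors and on functionals\<close>

lemma transvection_scale:
  "transvection scale \<omega> (scale c s) k = transvection scale \<omega> s (c * c * k)"
  by (simp add: transvection_def mult_ac)

lemma transvection_zero: "transvection scale \<omega> s 0 = id"
  by (auto simp: transvection_def)

lemma transvection_radical: "s \<in> radical \<Longrightarrow> transvection scale \<omega> s k = id"
  by (auto simp: transvection_def radical_def form_swap[of _ s])

text \<open>Each transvection is an isometry of \<omega>, with inverse obtained by negating
  \<open>k\<close>; conjugation by an isometry moves only the direction vector.\<close>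

lemma transvection_conjugate:
  "transvection scale \<omega> v k \<circ> transvection scale \<omega> u m \<circ> transvection scale \<omega> v (- k)
    = transvection scale \<omega> (transvection scale \<omega> v k u) m"
  by (rule ext)
    (simp add: transvection_def algebra_simps form_swap[of v u])

text \<open>The minus sign comes from swapping \<omega>(x,s) into \<omega>(s,x). Writing the
  increment as \<omega> of a multiple of \<open>s\<close> displays it as an element of
  \<open>range \<omega>\<close>.\<close>

lemma functional_transvection:
  assumes "\<gamma> \<in> dual_space scale"
  shows "\<gamma> \<circ> transvection scale \<omega> s k = \<gamma> + \<omega> (scale (- k * \<gamma> s) s)"
  using assms by (auto simp: dual_space_def Vector_Spaces.linear_iff transvection_def
      form_swap[of s] mult_ac)

lemma transvection_functional_diff:
  assumes "\<gamma> \<in> dual_space scale"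
  shows "(\<gamma> \<circ> transvection scale \<omega> s k) - \<gamma> \<in> range \<omega>"
  unfolding functional_transvection[OF assms] by simp

lemma form_range_add: "f \<in> range \<omega> \<Longrightarrow> g \<in> range \<omega> \<Longrightarrow> f + g \<in> range \<omega>"
proof (elim imageE)
  fix x y assume "f = \<omega> x" "g = \<omega> y"
  then show ?thesis by (intro range_eqI[of _ _ "x + y"]) auto
qed

lemma form_range_minus: "f \<in> range \<omega> \<Longrightarrow> - f \<in> range \<omega>"
proof (elim imageE)
  fix x assume "f = \<omega> x"
  then show ?thesis by (intro range_eqI[of _ _ "- x"]) auto
qed

lemma dual_space_diff:
  assumes "\<gamma> \<in> dual_space scale"
  shows "\<gamma> (x - y) = \<gamma> x - \<gamma> y"
proof -
  have "\<gamma> (a + b) = \<gamma> a + \<gamma> b" for a b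
    using assms by (auto simp: dual_space_def Vector_Spaces.linear_iff)
  from this[of "x - y" y] show ?thesis by simp
qed

lemma functional_GL:
  assumes "\<gamma> \<in> dual_space scale" "g \<in> carrier (GL scale)"
  shows "\<gamma> \<circ> g \<in> dual_space scale"
  using assms Vector_Spaces.linear_compose[of scale scale g "(*)" \<gamma>]
  by (auto simp: GL_def dual_space_def)

section \<open>The generated group and its orbits on the dual space\<close>

lemma Gamma_subset_GL: "Gamma scale \<omega> S \<subseteq> carrier (GL scale)"
  using subgroup.subset[OF subgroup_Gamma[OF vector_space_axioms alternating]] .

lemma Gamma_comp:
  "g \<in> Gamma scale \<omega> S \<Longrightarrow> h \<in> Gamma scale \<omega> S \<Longrightarrow> g \<circ> h \<in> Gamma scale \<omega> S"
  using subgroup.m_closed[OF subgroup_Gamma[OF vector_space_axioms alternating]]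
  by (simp add: GL_def)

lemma id_in_Gamma: "id \<in> Gamma scale \<omega> S"
  using subgroup.one_closed[OF subgroup_Gamma[OF vector_space_axioms alternating]]
  by (simp add: GL_def)

text \<open>Induction on the generation of \<open>g\<close>. The functional stays arbitrary because
  in a product the second factor acts on \<gamma> already composed with the first.\<close>

lemma Gamma_functional_diff:
  assumes "g \<in> Gamma scale \<omega> S" "\<gamma> \<in> dual_space scale"
  shows "(\<gamma> \<circ> g) - \<gamma> \<in> range \<omega>"
  using assms unfolding Gamma_def
proof (induction g arbitrary: \<gamma> rule: generate.induct)
  case one
  show ?case by (rule range_eqI[of _ _ 0]) (auto simp: GL_def)
next
  case (incl h)
  then obtain s k where "h = transvection scale \<omega> s k" by auto
  then show ?case using transvection_functional_diff[OF incl(2)] by metis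
next
  case (inv h)
  interpret GL: group "GL scale" by (rule group_GL[OF vector_space_axioms])
  from inv obtain s k where h: "h = transvection scale \<omega> s k" by auto
  then have hG: "h \<in> carrier (GL scale)"
    using transvection_in_GL[OF vector_space_axioms alternating] by simp
  \<comment> \<open>The inverse of a generator is handled by applying the generator itself to
    \<open>?\<delta>\<close>, which it takes back to \<gamma>.\<close>
  let ?\<delta> = "\<gamma> \<circ> inv\<^bsub>GL scale\<^esub> h"
  have "inv\<^bsub>GL scale\<^esub> h \<circ> h = id"
    using GL.l_inv[OF hG] by (simp add: GL_def)
  then have "?\<delta> \<circ> h = \<gamma>" by (simp add: comp_assoc)
  moreover have "(?\<delta> \<circ> h) - ?\<delta> \<in> range \<omega>"
    unfolding h using functional_GL[OF inv(2) GL.inv_closed[OF hG]] h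
    by (intro transvection_functional_diff) simp
  ultimately have "- (\<gamma> - ?\<delta>) \<in> range \<omega>" using form_range_minus by metis
  then show ?case unfolding minus_diff_eq .
next
  case (eng g h)
  have "g \<in> carrier (GL scale)"
    using eng(1) Gamma_subset_GL by (auto simp: Gamma_def)
  then have "(\<gamma> \<circ> g \<circ> h) - (\<gamma> \<circ> g) \<in> range \<omega>" "(\<gamma> \<circ> g) - \<gamma> \<in> range \<omega>"
    using eng functional_GL by blast+
  note form_range_add[OF this]
  also have "((\<gamma> \<circ> g \<circ> h) - (\<gamma> \<circ> g)) + ((\<gamma> \<circ> g) - \<gamma>) = (\<gamma> \<circ> (g \<otimes>\<^bsub>GL scale\<^esub> h)) - \<gamma>"
    by (simp add: GL_def fun_eq_iff)
  finally show ?case .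
qed

lemma same_orbit_iff:
  assumes "\<alpha> \<in> dual_space scale" "\<beta> \<in> dual_space scale"
  shows "(\<exists>Q \<in> orbits (Gamma_dual scale \<omega> S) (dual_space scale) (\<lambda>h. h). \<alpha> \<in> Q \<and> \<beta> \<in> Q)
    \<longleftrightarrow> (\<exists>g \<in> Gamma scale \<omega> S. \<beta> = \<alpha> \<circ> g)"
proof -
  interpret group_action "Gamma_dual scale \<omega> S" "dual_space scale" "\<lambda>h. h"
    by (rule group_action_Gamma_dual[OF vector_space_axioms alternating])
  have orbit: "orbit (Gamma_dual scale \<omega> S) (\<lambda>h. h) \<gamma> = {\<gamma> \<circ> g |g. g \<in> Gamma scale \<omega> S}"
    if "\<gamma> \<in> dual_space scale" for \<gamma>
  proof -
    have "orbit (Gamma_dual scale \<omega> S) (\<lambda>h. h) \<gamma> = (\<lambda>g. dual_map scale g \<gamma>) ` Gamma scale \<omega> S"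
      by (auto simp: orbit_def Gamma_dual_def)
    also have "\<dots> = {\<gamma> \<circ> g |g. g \<in> Gamma scale \<omega> S}"
      using that by (auto simp: dual_map_def)
    finally show ?thesis .
  qed
  show ?thesis
  proof
    assume "\<exists>Q \<in> orbits (Gamma_dual scale \<omega> S) (dual_space scale) (\<lambda>h. h). \<alpha> \<in> Q \<and> \<beta> \<in> Q"
    then obtain \<gamma> where \<gamma>: "\<gamma> \<in> dual_space scale"
      and "\<alpha> \<in> orbit (Gamma_dual scale \<omega> S) (\<lambda>h. h) \<gamma>"
      and \<beta>: "\<beta> \<in> orbit (Gamma_dual scale \<omega> S) (\<lambda>h. h) \<gamma>"
      by (auto simp: orbits_def)
    then have "\<gamma> \<in> orbit (Gamma_dual scale \<omega> S) (\<lambda>h. h) \<alpha>"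
      using orbit_sym assms by blast
    then have "\<beta> \<in> orbit (Gamma_dual scale \<omega> S) (\<lambda>h. h) \<alpha>"
      using orbit_trans \<beta> \<gamma> assms by blast
    then show "\<exists>g \<in> Gamma scale \<omega> S. \<beta> = \<alpha> \<circ> g"
      by (auto simp: orbit[OF assms(1)])
  next
    assume "\<exists>g \<in> Gamma scale \<omega> S. \<beta> = \<alpha> \<circ> g"
    moreover have "\<alpha> = \<alpha> \<circ> id" by simp
    ultimately show "\<exists>Q \<in> orbits (Gamma_dual scale \<omega> S) (dual_space scale) (\<lambda>h. h).
        \<alpha> \<in> Q \<and> \<beta> \<in> Q"
      using orbit[OF assms(1)] assms(1) id_in_Gamma unfolding orbits_def by blast
  qed
qed

section \<open>Orbits when all transvections are available\<close>

lemma common_nonzero: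
  assumes "\<alpha> \<in> dual_space scale" "\<alpha> \<noteq> (\<lambda>_. 0)" "\<beta> \<in> dual_space scale" "\<beta> \<noteq> (\<lambda>_. 0)"
  obtains y where "\<alpha> y \<noteq> 0" "\<beta> y \<noteq> 0"
proof -
  obtain a b where "\<alpha> a \<noteq> 0" "\<beta> b \<noteq> 0" using assms by blast
  moreover have "\<alpha> (a + b) = \<alpha> a + \<alpha> b" "\<beta> (a + b) = \<beta> a + \<beta> b"
    using assms by (auto simp: dual_space_def Vector_Spaces.linear_iff)
  \<comment> \<open>Two proper subspaces never cover a space: if \<beta>(a) = 0 and \<alpha>(b) = 0,
    neither functional vanishes at \<open>a + b\<close>.\<close>
  ultimately show ?thesis
    using that[of a] that[of b] that[of "a + b"] by fastforce
qed

lemma all_transvections_orbit: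
  assumes all: "\<And>x k. transvection scale \<omega> x k \<in> Gamma scale \<omega> S"
    and "\<alpha> \<in> dual_space scale" "\<alpha> \<noteq> (\<lambda>_. 0)" "\<beta> \<in> dual_space scale" "\<beta> \<noteq> (\<lambda>_. 0)"
    and "\<beta> - \<alpha> = \<omega> x"
  shows "\<exists>g \<in> Gamma scale \<omega> S. \<beta> = \<alpha> \<circ> g"
proof -
  obtain y where y: "\<alpha> y \<noteq> 0" "\<beta> y \<noteq> 0"
    using common_nonzero assms by metis
  \<comment> \<open>The choice k = -1/\<gamma>(z) turns the coefficient -k \<gamma>(z) into
    1.\<close>
  have move: "\<exists>g \<in> Gamma scale \<omega> S. \<gamma> \<circ> g = \<gamma> + \<omega> z"
    if "\<gamma> \<in> dual_space scale" "\<gamma> z \<noteq> 0" for \<gamma> z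
    using that by (intro bexI[OF _ all[of z "- inverse (\<gamma> z)"]]) (simp add: functional_transvection)
  from move[of \<alpha> y] y assms obtain g
    where g: "g \<in> Gamma scale \<omega> S" "\<alpha> \<circ> g = \<alpha> + \<omega> y" by blast
  have \<beta>: "\<beta> z = \<alpha> z + \<omega> x z" for z
    using fun_cong[OF assms(6), of z] by (simp add: algebra_simps)
  have "\<alpha> x = \<beta> x" by (simp add: \<beta>)
  show ?thesis
  proof (cases "\<alpha> x = 0")
    case False
    from move[OF assms(2) this] obtain h
      where "h \<in> Gamma scale \<omega> S" "\<alpha> \<circ> h = \<alpha> + \<omega> x" by blast
    then show ?thesis by (intro bexI[of _ h]) (auto simp: \<beta>)
  next
    case True
    have dual: "\<alpha> + \<omega> y \<in> dual_space scale"
      using functional_GL[OF assms(2)] g Gamma_subset_GL by (metis subsetD)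
    have "\<alpha> (x - y) = \<alpha> x - \<alpha> y"
      using dual_space_diff[OF assms(2)] by simp
    \<comment> \<open>Since \<alpha>(x) = 0, the value collapses to -(\<alpha>(y) + \<omega>(x,y));
      this is why \<beta>(y) must not vanish.\<close>
    then have "(\<alpha> + \<omega> y) (x - y) = - \<beta> y"
      by (simp add: \<beta> True form_swap[of y x])
    with y(2) have "(\<alpha> + \<omega> y) (x - y) \<noteq> 0" by simp
    from move[OF dual this] obtain h
      where h: "h \<in> Gamma scale \<omega> S" "(\<alpha> + \<omega> y) \<circ> h = \<alpha> + \<omega> y + \<omega> (x - y)"
      by blast
    have "\<alpha> \<circ> (g \<circ> h) = \<alpha> + \<omega> y + \<omega> (x - y)"
      by (simp only: o_assoc g(2) h(2))
    also have "\<dots> = \<beta>"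
      by (rule ext) (simp add: \<beta>)
    finally show ?thesis
      using Gamma_comp[OF g(1) h(1)] by metis
  qed
qed

end

section \<open>Sets of directions closed under non-orthogonal sums\<close>

locale transvection_closed = alternating_form scale \<omega>
  for scale :: "'k::field \<Rightarrow> 'x::ab_group_add \<Rightarrow> 'x" and \<omega> +
  fixes R :: "'x set"
  assumes card_field: "card (UNIV :: 'k set) \<noteq> 2"
    and radical_subset: "radical \<subseteq> R"
    and scale_closed: "x \<in> R \<Longrightarrow> scale c x \<in> R"
    and add_closed: "u \<in> R \<Longrightarrow> v \<in> R \<Longrightarrow> \<omega> u v \<noteq> 0 \<Longrightarrow> u + v \<in> R"
begin

text \<open>Otherwise \<open>1 = a\<close> and the field is {0, 1}. As \<open>card\<close> is 0 on
  infinite types, infinite fields are covered too.\<close>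

lemma obtain_scalar:
  fixes a :: 'k
  obtains d where "d \<noteq> 0" "d \<noteq> a"
proof -
  have "\<exists>d::'k. d \<noteq> 0 \<and> d \<noteq> a"
  proof (rule ccontr)
    assume "\<not> (\<exists>d::'k. d \<noteq> 0 \<and> d \<noteq> a)"
    then have *: "d = 0 \<or> d = a" for d by blast
    from *[of 1] have "a = 1" by auto
    with * have "(UNIV :: 'k set) = {0, 1}" by auto
    moreover have "card {0, 1 :: 'k} = 2" by simp
    ultimately have "card (UNIV :: 'k set) = 2" by metis
    with card_field show False by simp
  qed
  then show ?thesis using that by blast
qed

lemma add_common_neighbour_nonorthogonal:
  assumes "u \<in> R" "v \<in> R" "w \<in> R" "\<omega> u w \<noteq> 0" "\<omega> v w \<noteq> 0" "\<omega> (u + v) w \<noteq> 0"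
  shows "u + v \<in> R"
proof (cases "\<omega> u v = 0")
  case True
  \<comment> \<open>For orthogonal \<open>u\<close> and \<open>v\<close> the route is u, u + w, u +
    w + v, u + v: each summand is non-orthogonal to the sum reached so far.\<close>
  have "u + w \<in> R" using assms add_closed by blast
  moreover have "\<omega> (u + w) v \<noteq> 0" using True assms(5) form_eq_0_swap[of v w] by simp
  ultimately have "(u + w) + v \<in> R" using assms add_closed by blast
  moreover have "\<omega> ((u + w) + v) (- w) = - \<omega> (u + v) w" by simp
  then have "\<omega> ((u + w) + v) (- w) \<noteq> 0" using assms(6) by (metis neg_equal_0_iff_equal)
  moreover have "- w \<in> R" using scale_closed[OF assms(3), of "-1"] by simp
  ultimately have "(u + w) + v + (- w) \<in> R" using add_closed by blast
  then show ?thesis by (simp add: algebra_simps)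
qed (use assms add_closed in blast)

lemma add_common_neighbour:
  assumes S: "S \<subseteq> R" "span S = UNIV"
    and "u \<in> R" "v \<in> R" "w \<in> R" "\<omega> u w \<noteq> 0" "\<omega> v w \<noteq> 0"
  shows "u + v \<in> R"
proof (cases "u + v \<in> radical")
  case False
  \<comment> \<open>It suffices to find a common neighbour in \<open>R\<close> that also sees
    \<open>u + v\<close>. Either \<open>w\<close> or \<open>z\<close> may already do; otherwise they
    are mixed.\<close>
  have *: "u + v \<in> R"
    if uv: "u \<in> R" "v \<in> R" "\<omega> u w \<noteq> 0" "\<omega> v w \<noteq> 0"
      and z: "z \<in> R" "\<omega> (u + v) z \<noteq> 0" "\<omega> u z \<noteq> 0" for u v z
  proof (cases "\<omega> (u + v) w \<noteq> 0 \<or> \<omega> v z \<noteq> 0")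
    case True
    then show ?thesis using that assms(5) add_common_neighbour_nonorthogonal by blast
  next
    case nz: False
    \<comment> \<open>Here \<open>u + v\<close> is orthogonal to \<open>w\<close> and
      \<open>v\<close> to \<open>z\<close>. So d \<noteq> 0 makes \<open>u + v\<close> see
      \<open>?z\<close>, the second condition keeps \<open>u\<close> seeing it, and \<open>v\<close>
      sees it through \<open>w\<close>. It lies in \<open>R\<close> because \<open>w\<close> and
      \<open>scale d z\<close> share the neighbour \<open>u\<close>.\<close>
    obtain d where d: "d \<noteq> 0" "d \<noteq> - \<omega> u w / \<omega> u z" using obtain_scalar .
    let ?z = "w + scale d z"
    have uz: "\<omega> u ?z \<noteq> 0"
      using d(2) z(3) by (auto simp: field_simps eq_neg_iff_add_eq_0 add.commute)
    have "\<omega> v ?z \<noteq> 0" using nz uv by simp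
    moreover have "\<omega> (u + v) ?z \<noteq> 0" using nz d z by auto
    moreover have "?z \<in> R"
    proof (rule add_common_neighbour_nonorthogonal[of w "scale d z" u])
      show "scale d z \<in> R" using scale_closed z(1) by blast
      show "\<omega> w u \<noteq> 0" using uv(3) form_eq_0_swap by blast
      show "\<omega> (scale d z) u \<noteq> 0" using d(1) z(3) form_eq_0_swap[of z u] by simp
      show "\<omega> ?z u \<noteq> 0" using uz form_eq_0_swap by blast
    qed fact+
    ultimately show ?thesis
      using uz uv add_common_neighbour_nonorthogonal by blast
  qed
  \<comment> \<open>Such a \<open>z\<close> sees \<open>u\<close> or \<open>v\<close>, and the claim
    above is symmetric in the two.\<close>
  obtain z where "z \<in> S" "\<omega> (u + v) z \<noteq> 0"
    using not_radical_obtains[OF S(2) False] .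
  moreover from this have "\<omega> u z \<noteq> 0 \<or> \<omega> v z \<noteq> 0" by auto
  ultimately show ?thesis
    using *[of u v z] *[of v u z] assms by (auto simp: add.commute)
qed (use radical_subset in blast)

definition linked :: "'x \<Rightarrow> 'x \<Rightarrow> bool"
  where "linked u v \<longleftrightarrow> (\<exists>w\<in>R. \<omega> u w \<noteq> 0 \<and> \<omega> v w \<noteq> 0)"

lemma linked_sym: "linked u v \<Longrightarrow> linked v u"
  by (auto simp: linked_def)

text \<open>The sum \<open>u + v\<close> is itself the common neighbour.\<close>

lemma linked_adjacent:
  assumes "u \<in> R" "v \<in> R" "\<omega> u v \<noteq> 0"
  shows "linked u v"
  unfolding linked_def
  using assms add_closed[OF assms] form_eq_0_swap[of u v] by (intro bexI[of _ "u + v"]) auto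

text \<open>If neither \<open>a\<close> nor \<open>b\<close> sees both ends, then \<omega>(u,b) = 0
  = \<omega>(w,a) and \<open>a + b\<close> sees both; it is in \<open>R\<close> because
  \<open>a\<close> and \<open>b\<close> share the neighbour \<open>v\<close>.\<close>

lemma linked_trans:
  assumes S: "S \<subseteq> R" "span S = UNIV" and "v \<in> R" "linked u v" "linked v w"
  shows "linked u w"
proof -
  obtain a b where a: "a \<in> R" "\<omega> u a \<noteq> 0" "\<omega> v a \<noteq> 0" and b: "b \<in> R" "\<omega> v b \<noteq> 0" "\<omega> w b \<noteq> 0"
    using assms by (auto simp: linked_def)
  have "a + b \<in> R"
    using add_common_neighbour[OF S a(1) b(1) assms(3)] a b form_eq_0_swap by blast
  then show ?thesis
    using a b unfolding linked_def
    by (cases "\<omega> u b = 0"; cases "\<omega> w a = 0") (auto intro: bexI[of _ "a + b"])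
qed

section \<open>From closure and connectedness to the whole space\<close>

lemma eq_UNIV:
  assumes S: "S \<subseteq> R" "span S = UNIV" and "S \<noteq> {}" "S \<inter> radical = {}"
    and conn: "\<And>s t. s \<in> S \<Longrightarrow> t \<in> S \<Longrightarrow> (s, t) \<in> {(u, v). u \<in> S \<and> v \<in> S \<and> \<omega> u v \<noteq> 0}\<^sup>*"
  shows "R = UNIV"
proof -
  have adj: "\<exists>z\<in>S. \<omega> x z \<noteq> 0" if "x \<notin> radical" for x
    using not_radical_obtains[OF S(2) that] by blast
  have linked_S: "linked s t" if "s \<in> S" "t \<in> S" for s t
    using conn[OF that]
  proof (induction rule: rtrancl_induct)
    case base
    show ?case using adj[of s] S assms(4) that unfolding linked_def by blast
  next
    case (step y z)
    then show ?case using linked_trans[OF S] linked_adjacent S by blast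
  qed
  have linked_all: "linked u v" if uv: "u \<in> R" "v \<in> R" "u \<notin> radical" "v \<notin> radical" for u v
  proof -
    obtain s where s: "s \<in> S" "\<omega> u s \<noteq> 0" using adj[OF uv(3)] by blast
    obtain t where t: "t \<in> S" "\<omega> v t \<noteq> 0" using adj[OF uv(4)] by blast
    have "s \<in> R" "t \<in> R" using s t S by blast+
    moreover from this have "linked u s" "linked s t" "linked t v"
      using linked_S linked_adjacent linked_sym uv s t by blast+
    ultimately show ?thesis using linked_trans[OF S] by blast
  qed
  have sum: "u + v \<in> R" if "u \<in> R" "v \<in> R" "u \<notin> radical" "v \<notin> radical" for u v
    using linked_all[OF that] add_common_neighbour[OF S that(1,2)] unfolding linked_def by blast
  \<comment> \<open>\<open>R\<close> is not visibly a subspace, since sums are controlled only for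
    non-radical summands. The set \<open>Q\<close> of admissible increments is shown to be a
    subspace containing \<open>S\<close>.\<close>
  define Q where "Q = {x. \<forall>u\<in>R. u \<notin> radical \<longrightarrow> u + x \<in> R}"
  have QD: "u + x \<in> R" if "x \<in> Q" "u \<in> R" "u \<notin> radical" for u x
    using that by (auto simp: Q_def)
  have Q_scale: "scale c x \<in> Q" if "x \<in> Q" for c x
  proof (cases "c = 0")
    case False
    have "u + scale c x \<in> R" if u: "u \<in> R" "u \<notin> radical" for u
    proof -
      have "scale (inverse c) u + x \<in> R"
        using u QD[OF \<open>x \<in> Q\<close>] scale_closed False scale_radical_iff by simp
      then have "scale c (scale (inverse c) u + x) \<in> R" by (rule scale_closed)
      then show ?thesis using False by (simp add: scale_right_distrib)
    qed
    then show ?thesis by (simp add: Q_def)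
  qed (simp add: Q_def)
  have S_Q: "S \<subseteq> Q"
    using sum S assms(4) unfolding Q_def by blast
  have Q_add: "x + y \<in> Q" if xy: "x \<in> Q" "y \<in> Q" for x y
  proof -
    have "u + (x + y) \<in> R" if u: "u \<in> R" "u \<notin> radical" for u
    proof (cases "u + x \<in> radical \<and> u + (x + y) \<notin> radical")
      case False
      then show ?thesis
        using QD[OF xy(2) QD[OF xy(1) u]] radical_subset by (auto simp: add.assoc)
    next
      \<comment> \<open>Adding \<open>x\<close> lands in the radical, where \<open>y\<close> can no
        longer be added by the definition of \<open>Q\<close>. The detour adds
        \<open>scale d z\<close> first and removes it last; \<open>d\<close> keeps both intermediate
        sums outside the radical.\<close>
      case True
      obtain z where z: "z \<in> S" "\<omega> u z \<noteq> 0" using adj u by blast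
      have zn: "z \<notin> radical" using z form_eq_0_swap[of z u] not_radicalI by blast
      obtain d where d: "d \<noteq> 0" "scale d z + y \<notin> radical"
      proof (cases "z + y \<in> radical")
        case False
        then show ?thesis using that[of 1] by simp
      next
        case zy: True
        obtain d where d: "d \<noteq> 0" "d \<noteq> (1 :: 'k)" using obtain_scalar .
        have "scale d z + y \<notin> radical"
        proof
          assume "scale d z + y \<in> radical"
          \<comment> \<open>Modulo the radical vector \<open>z + y\<close> only (d - 1) z remains,
            which is why \<open>d\<close> avoids 1.\<close>
          also have "scale d z + y = (z + y) + scale (d - 1) z"
            by (simp add: scale_left_diff_distrib)
          finally have "scale (d - 1) z \<in> radical" using add_radical_iff[OF zy] by blast
          then show False using d(2) zn by (simp add: scale_radical_iff)
        qed
        then show ?thesis using that d by blast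
      qed
      have uz: "\<omega> u (scale d z) \<noteq> 0" using z(2) d(1) by simp
      then have "\<omega> (u + scale d z) z \<noteq> 0" using z(2) by simp
      then have 1: "u + scale d z \<in> R" "u + scale d z \<notin> radical"
        using add_closed[OF u(1) scale_closed uz] S(1) z(1) not_radicalI by blast+
      have "u + scale d z + x \<in> R" using QD xy 1 by blast
      moreover have "u + scale d z + x \<notin> radical"
        using add_radical_iff[of "u + x" "scale d z"] True zn d(1)
        by (simp add: scale_radical_iff add_ac)
      ultimately have "u + scale d z + x + y \<in> R" using QD xy by blast
      moreover have "u + scale d z + x + y \<notin> radical"
        using add_radical_iff[of "u + x" "scale d z + y"] True d(2) by (simp add: add_ac)
      ultimately have "(u + scale d z + x + y) + scale (- d) z \<in> R"
        using QD Q_scale S_Q z by blast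
      then show ?thesis by (simp add: algebra_simps)
    qed
    then show ?thesis by (simp add: Q_def)
  qed
  have "0 \<in> Q" by (simp add: Q_def)
  then have "subspace Q" using Q_add Q_scale by (simp add: subspace_def)
  then have Q: "Q = UNIV" using span_minimal[OF S_Q] S(2) by auto
  obtain s where "s \<in> S" using assms by blast
  have "x \<in> R" for x
    using QD[of "x - s" s] Q \<open>s \<in> S\<close> S assms(4) by auto
  then show ?thesis by blast
qed

end

section \<open>Transvections in the generated group and the orbit criterion\<close>

theorem theorem8p4:
  fixes scale :: "'k::field \<Rightarrow> 'x::ab_group_add \<Rightarrow> 'x"
    and Basis :: "'x set"
    and \<omega> :: "'x \<Rightarrow> 'x \<Rightarrow> 'k"
    and S :: "'x set"
    and \<alpha> \<beta> :: "'x \<Rightarrow> 'k"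
  assumes "card (UNIV :: 'k set) \<noteq> 2"
    and "finite_dimensional_vector_space scale Basis"
    and "alternating_bilinear_form scale \<omega>"
    and "module.span scale S = UNIV"
    and "connected (with_proj (form_graph \<omega> S))"
    and "\<alpha> \<in> dual_space scale" and "\<alpha> \<noteq> (\<lambda>_. 0)"
    and "\<beta> \<in> dual_space scale" and "\<beta> \<noteq> (\<lambda>_. 0)"
  shows "(\<exists>Q \<in> orbits (Gamma_dual scale \<omega> S) (dual_space scale) (\<lambda>h. h). \<alpha> \<in> Q \<and> \<beta> \<in> Q)
    \<longleftrightarrow> \<beta> - \<alpha> \<in> range \<omega>"
proof -
  interpret finite_dimensional_vector_space scale Basis by fact
  interpret alternating_form scale \<omega>
    by unfold_locales fact
  let ?E = "{(u, v). u \<in> S \<and> v \<in> S \<and> \<omega> u v \<noteq> 0}"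
  define R where "R = {x. \<forall>k. transvection scale \<omega> x k \<in> Gamma scale \<omega> S}"
  \<comment> \<open>\<open>connected\<close> speaks of the symmetrised graph; orthogonality is
    symmetric, so no arcs are added.\<close>
  have "parcs (mk_symmetric (with_proj (form_graph \<omega> S))) = ?E"
    by (auto simp: parcs_mk_symmetric form_graph_def form_eq_0_swap)
  then have S_ne: "S \<noteq> {}"
    and "\<forall>s\<in>S. \<forall>t\<in>S. (s, t) \<in> rtrancl_on S ?E"
    using assms(5) by (auto simp: connected_def strongly_connected_def reachable_def form_graph_def)
  then have conn: "(s, t) \<in> ?E\<^sup>*" if "s \<in> S" "t \<in> S" for s t
    using that by (blast intro: rtrancl_on_rtranclI)
  have S_R: "S \<subseteq> R"
  proof
    fix s assume "s \<in> S"
    \<comment> \<open>Generators have k \<noteq> 0, while \<open>R\<close> quantifies over every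
      \<open>k\<close>; the value 0 gives the identity.\<close>
    then have "transvection scale \<omega> s k \<in> Gamma scale \<omega> S" for k
      using id_in_Gamma transvection_zero unfolding Gamma_def
      by (cases "k = 0") (auto intro: generate.incl)
    then show "s \<in> R" by (simp add: R_def)
  qed
  have "R = UNIV"
  proof (cases "radical = UNIV")
    case True
    then show ?thesis using transvection_radical id_in_Gamma by (auto simp: R_def)
  next
    case False
    interpret transvection_closed scale \<omega> R
    proof
      show "card (UNIV :: 'k set) \<noteq> 2" by fact
      show "radical \<subseteq> R"
        using transvection_radical id_in_Gamma by (auto simp: R_def)
      show "scale c x \<in> R" if "x \<in> R" for c x
        using that by (simp add: R_def transvection_scale)
      show "u + v \<in> R" if "u \<in> R" "v \<in> R" "\<omega> u v \<noteq> 0" for u v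
      proof -
        \<comment> \<open>This scalar makes the transvection along \<open>v\<close> send
          \<open>u\<close> to exactly \<open>u + v\<close>.\<close>
        let ?k = "inverse (\<omega> u v)"
        have "transvection scale \<omega> v ?k u = u + v"
          using that by (simp add: transvection_def)
        then have "transvection scale \<omega> (u + v) m = transvection scale \<omega> v ?k
            \<circ> transvection scale \<omega> u m \<circ> transvection scale \<omega> v (- ?k)" for m
          by (simp add: transvection_conjugate)
        then show ?thesis using that Gamma_comp by (auto simp: R_def)
      qed
    qed
    \<comment> \<open>A radical vertex is isolated, so connectedness would leave \<open>S\<close>
      with that vertex alone, and spanning would force \<omega> = 0.\<close>
    have "s \<notin> radical" if s: "s \<in> S" for s
    proof
      assume rad: "s \<in> radical"
      have "t = s" if "t \<in> S" for t
        using conn[OF s that] by (rule converse_rtranclE) (use rad in \<open>auto simp: radical_def\<close>)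
      moreover obtain x where "x \<notin> radical" using False by blast
      then obtain z where "z \<in> S" "\<omega> x z \<noteq> 0" using not_radical_obtains assms(4) by blast
      ultimately show False using rad form_eq_0_swap[of x s] by (auto simp: radical_def)
    qed
    then show ?thesis
      using eq_UNIV[OF S_R assms(4) S_ne _ conn] by blast
  qed
  then have all: "transvection scale \<omega> x k \<in> Gamma scale \<omega> S" for x k
    by (auto simp: R_def)
  show ?thesis
    unfolding same_orbit_iff[OF assms(6,8)]
    using Gamma_functional_diff[OF _ assms(6)] all_transvections_orbit[OF all assms(6-9)] by blast
qed

end
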